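(* Let $R$ be a discrete valuation ring with fraction field $K$. Then the Bruhat--Tits graph $\mathcal{T}$ of $R$ is a tree, i.e. the simple graph $\mathcal{T}$ is connected and acyclic.
   Context: Let $R$ be a discrete valuation ring with uniformiser $\varpi$ and fraction field $K$ (no completeness is assumed). An $R$-lattice in $K^2$ is a finitely generated $R$-submodule $L\subset K^2$ that spans $K^2$ as a $K$-vector space. Two lattices $L,L'$ are homothetic if there is $\alpha\in K^\times$ with $L=\alpha L'$. The vertex set $V(\mathcal{T})$ of the Bruhat--Tits graph is the set of homothety classes of $R$-lattices in $K^2$. Distance: for lattices $M,L$ there are an ordered $R$-basis $(e,f)$ of $M$ and integers $n\ge m$ such that $(\varpi^n e,\varpi^m f)$ is an $R$-basis of $L$, and the pair $(n,m)$ is uniquely determined by $M$ and $L$; set $d(M,L)=n-m$. This number depends only on the homothety classes of $M$ and $L$ and is symmetric, so it induces a function $d$ on pairs of vertices. Two vertices $v,v'$ are joined by an edge (are neighbours) if and only if $d(v,v')=1$. Equivalently, there are representatives $v=[L]$, $v'=[L']$ with $\varpi L\subsetneq L'\subsetneq L$. This defines the simple graph $\mathcal{T}$. *)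

theory Defs
  imports
    "HOL-Analysis.Cartesian_Space"
    "HOL-Computational_Algebra.Fraction_Field"
    "Graph_Theory.Graph_Theory"
begin

section \<open>Discrete valuation rings\<close>

text \<open>Submodules of a ring over itself are its ideals, and \<open>ring_mod.span A\<close> is the ideal
  generated by \<open>A\<close>.\<close>

global_interpretation ring_mod: module "(*) :: 'r::comm_ring_1 \<Rightarrow> 'r \<Rightarrow> 'r"
  by unfold_locales (simp_all add: algebra_simps)

abbreviation ring_ideal :: "'r::comm_ring_1 set \<Rightarrow> bool" where
  "ring_ideal I \<equiv> ring_mod.subspace I"

definition principal_ring_ideal :: "'r::comm_ring_1 set \<Rightarrow> bool" where
  "principal_ring_ideal I \<longleftrightarrow> (\<exists>a. I = ring_mod.span {a})"

definition maximal_ring_ideal :: "'r::comm_ring_1 set \<Rightarrow> bool" where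
  "maximal_ring_ideal I \<longleftrightarrow>
     ring_ideal I \<and> I \<noteq> UNIV \<and> (\<forall>J. ring_ideal J \<and> I \<subseteq> J \<longrightarrow> J = I \<or> J = UNIV)"

text \<open>A discrete valuation ring is a local principal ideal domain that is not a field.\<close>

definition discrete_valuation_ring :: "'r::idom itself \<Rightarrow> bool" where
  "discrete_valuation_ring _ \<longleftrightarrow>
     (\<forall>I :: 'r set. ring_ideal I \<longrightarrow> principal_ring_ideal I) \<and>
     (\<exists>!I :: 'r set. maximal_ring_ideal I) \<and>
     (\<exists>x :: 'r. x \<noteq> 0 \<and> \<not> x dvd 1)"

definition uniformiser :: "'r::idom \<Rightarrow> bool" where
  "uniformiser p \<longleftrightarrow> maximal_ring_ideal (ring_mod.span {p})"


section \<open>Lattices\<close>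

text \<open>The ring is the type \<open>'r\<close>, its fraction field is \<open>'r fract\<close>, and the latter's
  square is \<open>'r fract ^ 2\<close>.\<close>

definition frac_embed :: "'r::idom \<Rightarrow> 'r fract" where
  "frac_embed a = Fract a 1"

definition rscale :: "'r::idom \<Rightarrow> 'r fract ^ 2 \<Rightarrow> 'r fract ^ 2" where
  "rscale a x = frac_embed a *s x"

global_interpretation rmod: module "rscale :: 'r::idom \<Rightarrow> 'r fract ^ 2 \<Rightarrow> 'r fract ^ 2"
proof -
  have add: "frac_embed (a + b) = frac_embed a + frac_embed b" for a b :: 'r
    by (simp add: frac_embed_def)
  have mult: "frac_embed (a * b) = frac_embed a * frac_embed b" for a b :: 'r
    by (simp add: frac_embed_def)
  have one: "frac_embed (1 :: 'r) = 1"
    by (simp add: frac_embed_def One_fract_def)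
  show "module (rscale :: 'r \<Rightarrow> 'r fract ^ 2 \<Rightarrow> 'r fract ^ 2)"
    by unfold_locales
      (simp_all add: rscale_def add mult one vec.scale_right_distrib vec.scale_left_distrib)
qed

definition is_lattice :: "('r::idom fract ^ 2) set \<Rightarrow> bool" where
  "is_lattice L \<longleftrightarrow>
     rmod.subspace L \<and> (\<exists>B. finite B \<and> L = rmod.span B) \<and> vec.span L = UNIV"

definition homothety :: "(('r::idom fract ^ 2) set \<times> ('r fract ^ 2) set) set" where
  "homothety =
     {(L, L'). is_lattice L \<and> is_lattice L' \<and> (\<exists>\<alpha>. \<alpha> \<noteq> 0 \<and> L = (\<lambda>x. \<alpha> *s x) ` L')}"

definition homothety_classes :: "('r::idom fract ^ 2) set set set" where
  "homothety_classes = {L. is_lattice L} // homothety"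


section \<open>Distance\<close>

definition rbasis :: "'r::idom fract ^ 2 \<Rightarrow> 'r fract ^ 2 \<Rightarrow> ('r fract ^ 2) set \<Rightarrow> bool" where
  "rbasis e f M \<longleftrightarrow> e \<noteq> f \<and> rmod.independent {e, f} \<and> rmod.span {e, f} = M"

definition relative_exponents ::
  "'r::idom \<Rightarrow> ('r fract ^ 2) set \<Rightarrow> ('r fract ^ 2) set \<Rightarrow> int \<times> int \<Rightarrow> bool" where
  "relative_exponents p M L = (\<lambda>(n, m). n \<ge> m \<and>
     (\<exists>e f. rbasis e f M \<and>
        rbasis ((frac_embed p powi n) *s e) ((frac_embed p powi m) *s f) L))"

definition lattice_dist ::
  "'r::idom \<Rightarrow> ('r fract ^ 2) set \<Rightarrow> ('r fract ^ 2) set \<Rightarrow> int" where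
  "lattice_dist p M L = (case (THE nm. relative_exponents p M L nm) of (n, m) \<Rightarrow> n - m)"

definition vertex_dist ::
  "'r::idom \<Rightarrow> ('r fract ^ 2) set set \<Rightarrow> ('r fract ^ 2) set set \<Rightarrow> int" where
  "vertex_dist p v w = (THE d. \<exists>M\<in>v. \<exists>L\<in>w. d = lattice_dist p M L)"


section \<open>The Bruhat--Tits graph\<close>

text \<open>A simple graph is represented by the digraph having both arcs of every edge, that is, by a
  \<open>pair_bidirected_digraph\<close> (symmetric and loop-free).\<close>

definition bruhat_tits_graph :: "'r::idom \<Rightarrow> ('r fract ^ 2) set set pair_pre_digraph" where
  "bruhat_tits_graph p =
     \<lparr> pverts = homothety_classes,
       parcs = {(v, w). v \<in> homothety_classes \<and> w \<in> homothety_classes \<and>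
                        vertex_dist p v w = 1} \<rparr>"

text \<open>In a symmetric digraph every edge gives rise to directed cycles of length two, so
  the library's \<open>forest\<close> and \<open>tree\<close> do not apply. In a loop-free one, the
  directed cycles of length at least three are the cycles of the undirected graph.\<close>

definition acyclic_graph :: "'a pair_pre_digraph \<Rightarrow> bool" where
  "acyclic_graph G \<longleftrightarrow> \<not> (\<exists>c. pre_digraph.cycle (with_proj G) c \<and> length c \<ge> 3)"

definition tree_graph :: "'a pair_pre_digraph \<Rightarrow> bool" where
  "tree_graph G \<longleftrightarrow>
     pair_bidirected_digraph G \<and> Digraph_Component.connected (with_proj G) \<and> acyclic_graph G"

end

(* Every pair of lattices M, L has a basis (e, f) of M for which (p^n e, p^m f) is a basis of L, by
   the elementary divisor argument; m and n are read off from L <= p^k M <-> k <= m and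
   p^k M <= L <-> n <= k, which gives uniqueness. The classes of <p^i e, f> connect [M] to [L].
   For acyclicity fix a root M. If L <= M is not contained in p M, then a neighbour [L'] of [L],
   with p L < L' < L, that is not further from [M] than [L] must satisfy L' = L Int p M. So a vertex
   has at most one neighbour that is not further from the root, whereas a vertex on a cycle at
   maximal distance from the root would have two. *)

theory Submission
  imports Defs
begin

text \<open>A local principal ideal domain comes without a valuation, so one is produced first: by
  Krull's intersection theorem only finitely many powers of \<open>p\<close> divide a nonzero
  element. From then on the valuation appears through statements
  \<open>x / P powi k \<in> \<O>\<close>, and inclusions of lattices become such statements about
  coordinates in a common basis. The parent criterion compares heights by \<open>\<le>\<close>, not
  by \<open><\<close>. Next to a vertex of maximal height on a cycle, the heights are only known not
  to exceed the maximum, so a strict version would also require that adjacent vertices never have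
  the same distance from the root. The weak version costs nothing: if \<open>n\<close> is the
  distance of \<open>L\<close> from the root, the bound on the distance of \<open>L'\<close> serves
  only to place \<open>p ^ n M\<close> inside \<open>L'\<close>.\<close>

text \<open>For \<open>(*)\<close> as scalar multiplication this simp rule is associativity read from right to left,
  so it loops with \<open>algebra_simps\<close>.\<close>

declare ring_mod.scale_scale [simp del]

section \<open>Discrete valuation rings\<close>

lemma ring_span_singleton: "ring_mod.span {a} = {x :: 'r::comm_ring_1. a dvd x}"
  by (auto simp: ring_mod.span_singleton dvd_def mult.commute)

lemma ring_ideal_1: "ring_ideal (I :: 'r::comm_ring_1 set) \<Longrightarrow> 1 \<in> I \<longleftrightarrow> I = UNIV"
  using ring_mod.subspace_scale[of I 1] by auto

text \<open>Zorn's lemma. Properness is expressed as \<open>1 \<notin> J\<close>, a form that unions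
  of chains visibly preserve.\<close>

lemma ex_maximal_ring_ideal:
  fixes I :: "'r::comm_ring_1 set"
  assumes I: "ring_ideal I" "I \<noteq> UNIV"
  obtains J where "maximal_ring_ideal J" "I \<subseteq> J"
proof -
  define \<A> where "\<A> = {J. ring_ideal J \<and> 1 \<notin> J \<and> I \<subseteq> J}"
  have "\<exists>M\<in>\<A>. \<forall>X\<in>\<A>. M \<subseteq> X \<longrightarrow> X = M"
  proof (rule subset_Zorn_nonempty)
    show "\<A> \<noteq> {}"
      using I ring_ideal_1 by (auto simp: \<A>_def)
    fix \<C> assume ne: "\<C> \<noteq> {}" and C: "subset.chain \<A> \<C>"
    have sub: "\<C> \<subseteq> \<A>"
      using C by (auto simp: subset.chain_def)
    have "x + y \<in> \<Union>\<C>" if xy: "x \<in> \<Union>\<C>" "y \<in> \<Union>\<C>" for x y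
    proof -
      obtain X Y where XY: "x \<in> X" "X \<in> \<C>" "y \<in> Y" "Y \<in> \<C>"
        using xy by blast
      then consider "X \<subseteq> Y" | "Y \<subseteq> X"
        using C by (auto simp: subset.chain_def)
      then have "x + y \<in> X \<or> x + y \<in> Y"
        using XY sub by cases (auto simp: \<A>_def subset_iff intro!: ring_mod.subspace_add)
      then show ?thesis
        using XY by blast
    qed
    moreover have "0 \<in> X \<and> (\<forall>x\<in>X. c * x \<in> X) \<and> 1 \<notin> X \<and> I \<subseteq> X" if "X \<in> \<C>" for X c
      using sub that by (auto simp: \<A>_def ring_mod.subspace_0 ring_mod.subspace_scale)
    ultimately have "ring_ideal (\<Union>\<C>) \<and> 1 \<notin> \<Union>\<C> \<and> I \<subseteq> \<Union>\<C>"
      using ne unfolding ring_mod.subspace_def by (intro conjI ballI allI; blast)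
    then show "\<Union>\<C> \<in> \<A>"
      by (simp add: \<A>_def)
  qed
  then obtain M where M: "M \<in> \<A>" "\<And>X. X \<in> \<A> \<Longrightarrow> M \<subseteq> X \<Longrightarrow> X = M"
    by blast
  then have M': "ring_ideal M" "1 \<notin> M" "I \<subseteq> M"
    by (simp_all add: \<A>_def)
  have "J = M \<or> J = UNIV" if "ring_ideal J" "M \<subseteq> J" for J
    using M(2)[of J] M'(3) that ring_ideal_1[of J] unfolding \<A>_def by blast
  then have "maximal_ring_ideal M"
    using M' unfolding maximal_ring_ideal_def by blast
  then show thesis
    using M'(3) that by blast
qed

locale dvr =
  fixes p :: "'r::idom"
  assumes dvr: "discrete_valuation_ring TYPE('r)"
    and uniformiser: "uniformiser p"
begin

lemma not_p_dvd_1: "\<not> p dvd 1"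
proof
  assume "p dvd 1"
  then have "ring_mod.span {p} = UNIV"
    by (auto simp: ring_span_singleton intro: dvd_trans)
  then show False
    using uniformiser by (simp add: uniformiser_def maximal_ring_ideal_def)
qed

text \<open>A nonunit generates a proper ideal, which lies in a maximal one, and the only maximal
  ideal is the one generated by \<open>p\<close>. Locality is used from here on in this
  form.\<close>

lemma p_dvd_iff: "p dvd x \<longleftrightarrow> \<not> x dvd 1"
proof
  assume "\<not> x dvd 1"
  then have "ring_mod.span {x} \<noteq> UNIV"
    by (metis mem_Collect_eq ring_span_singleton UNIV_I)
  then obtain J where J: "maximal_ring_ideal J" "ring_mod.span {x} \<subseteq> J"
    using ex_maximal_ring_ideal ring_mod.subspace_span by blast
  moreover have "\<exists>!I :: 'r set. maximal_ring_ideal I" "maximal_ring_ideal (ring_mod.span {p})"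
    using dvr uniformiser by (simp_all add: discrete_valuation_ring_def uniformiser_def)
  ultimately have "J = ring_mod.span {p}"
    by blast
  moreover have "x \<in> J"
    using J(2) by (auto simp: ring_span_singleton)
  ultimately show "p dvd x"
    by (simp add: ring_span_singleton)
qed (use not_p_dvd_1 in \<open>blast intro: dvd_trans\<close>)

text \<open>This is where the ring not being a field enters: \<open>p\<close> divides some nonzero
  nonunit.\<close>

lemma p_nonzero [simp]: "p \<noteq> 0"
  using dvr p_dvd_iff by (auto simp: discrete_valuation_ring_def)

text \<open>Krull's intersection theorem: if \<open>a = p b\<close> generates the intersection of the powers of
  \<open>(p)\<close>, then \<open>b\<close> also lies in that intersection.\<close>

lemma eq_0_if_all_powers_dvd:
  assumes "\<And>n. p ^ n dvd x"
  shows "x = 0"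
proof -
  define I where "I = {x. \<forall>n. p ^ n dvd x}"
  have "ring_ideal I"
    by (auto simp: ring_mod.subspace_def I_def)
  then obtain a where a: "I = {x. a dvd x}"
    using dvr by (auto simp: discrete_valuation_ring_def principal_ring_ideal_def ring_span_singleton)
  then have "a \<in> I"
    by simp
  then have "p ^ 1 dvd a"
    unfolding I_def by blast
  then obtain b where b: "a = p * b"
    by auto
  have "p ^ n dvd b" for n
  proof -
    have "p ^ Suc n dvd p * b"
      using \<open>a \<in> I\<close> b unfolding I_def by blast
    then show ?thesis
      using p_nonzero by simp
  qed
  then have "a dvd b"
    using a by (auto simp: I_def)
  \<comment> \<open>Otherwise \<open>b\<close> could be cancelled from \<open>p * b dvd b\<close>,
    making \<open>p\<close> a unit.\<close>
  then have "b = 0"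
    using b not_p_dvd_1 by (metis dvd_mult_cancel_right mult_1)
  have "x \<in> I"
    using assms by (simp add: I_def)
  then have "p * b dvd x"
    using a b by blast
  then show ?thesis
    using \<open>b = 0\<close> by simp
qed

text \<open>One below the first exponent whose power of \<open>p\<close> fails to divide
  \<open>x\<close>, the cofactor is no longer divisible by \<open>p\<close>, hence a unit. That
  first exponent is positive because \<open>p ^ 0\<close> divides everything.\<close>

lemma unit_power_decomposition:
  assumes "x \<noteq> 0"
  obtains u n where "u dvd 1" "x = u * p ^ n"
proof -
  obtain n where n: "\<not> p ^ n dvd x"
    using assms eq_0_if_all_powers_dvd by blast
  define m where "m = (LEAST n. \<not> p ^ n dvd x)"
  have m: "\<not> p ^ m dvd x" "\<And>k. k < m \<Longrightarrow> p ^ k dvd x"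
    unfolding m_def using LeastI[of "\<lambda>n. \<not> p ^ n dvd x", OF n] not_less_Least by auto
  then obtain k where k: "m = Suc k"
    by (cases m) auto
  then obtain u where u: "x = p ^ k * u"
    using m(2)[of k] by auto
  have "\<not> p dvd u"
    using m(1) u k by auto
  then show thesis
    using that[of u k] u p_dvd_iff[of u] mult.commute[of u] by auto
qed

end

section \<open>The valuation ring in the fraction field\<close>

lemma frac_embed_0 [simp]: "frac_embed 0 = 0"
  and frac_embed_1 [simp]: "frac_embed 1 = 1"
  and frac_embed_add: "frac_embed (a + b) = frac_embed a + frac_embed b"
  and frac_embed_mult: "frac_embed (a * b) = frac_embed a * frac_embed b"
  by (simp_all add: frac_embed_def Zero_fract_def One_fract_def)

lemma frac_embed_power: "frac_embed (a ^ n) = frac_embed a ^ n"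
  by (induction n) (simp_all add: frac_embed_mult)

lemma frac_embed_eq_iff [simp]: "frac_embed a = frac_embed b \<longleftrightarrow> a = b"
  by (simp add: frac_embed_def eq_fract)

lemma frac_embed_eq_0_iff [simp]: "frac_embed a = 0 \<longleftrightarrow> a = 0"
  using frac_embed_eq_iff[of a 0] by (simp del: frac_embed_eq_iff)

lemma fract_eq_quotient:
  obtains a b where "b \<noteq> 0" "x = frac_embed a / frac_embed b"
  by (cases x) (auto simp: frac_embed_def)

text \<open>The copy of the ring inside its fraction field. With it, divisibility of
  \<open>x\<close> by any nonzero \<open>y\<close> of the field reads
  \<open>x / y \<in> \<O>\<close>.\<close>

definition \<O> :: "'r::idom fract set" where
  "\<O> = range frac_embed"

lemma O_0 [simp]: "0 \<in> \<O>" and O_1 [simp]: "1 \<in> \<O>"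
  using rangeI[of frac_embed 0] rangeI[of frac_embed 1] by (simp_all add: \<O>_def)

lemma O_embed [simp]: "frac_embed a \<in> \<O>"
  by (simp add: \<O>_def)

lemma O_add: "x \<in> \<O> \<Longrightarrow> y \<in> \<O> \<Longrightarrow> x + y \<in> \<O>"
  by (auto simp: \<O>_def simp flip: frac_embed_add)

lemma O_mult: "x \<in> \<O> \<Longrightarrow> y \<in> \<O> \<Longrightarrow> x * y \<in> \<O>"
  by (auto simp: \<O>_def simp flip: frac_embed_mult)

context dvr
begin

abbreviation P :: "'r fract" where
  "P \<equiv> frac_embed p"

lemma P_powi_in_O_iff [simp]: "P powi k \<in> \<O> \<longleftrightarrow> k \<ge> 0"
proof
  assume k: "P powi k \<in> \<O>"
  show "k \<ge> 0"
  proof (rule ccontr)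
    assume "\<not> k \<ge> 0"
    then obtain n where n: "k = - int (Suc n)"
      by (metis int_cases of_nat_0_le_iff)
    obtain a where a: "P powi k = frac_embed a"
      using k by (auto simp: \<O>_def)
    have "P powi k * P ^ Suc n = 1"
      unfolding n power_int_minus power_int_of_nat by (rule left_inverse) simp
    then have "frac_embed (a * p ^ Suc n) = frac_embed 1"
      unfolding a by (simp only: frac_embed_mult frac_embed_power frac_embed_1)
    then have "a * p ^ Suc n = 1"
      by (simp only: frac_embed_eq_iff)
    then show False
      using not_p_dvd_1 by (metis dvd_triv_left dvd_mult power_Suc)
  qed
next
  assume "k \<ge> 0"
  then have "P powi k = frac_embed (p ^ nat k)"
    by (simp add: power_int_def frac_embed_power)
  then show "P powi k \<in> \<O>"
    by simp
qed

text \<open>Numerator and denominator decompose separately; their unit parts are divided and their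
  exponents subtracted. Being a unit is recorded as \<open>u\<close> and \<open>inverse u\<close>
  both lying in \<open>\<O>\<close>.\<close>

lemma fract_decomposition:
  assumes "x \<noteq> 0"
  obtains u k where "u \<in> \<O>" "inverse u \<in> \<O>" "u \<noteq> 0" "x = u * P powi k"
proof -
  have unit: "frac_embed u \<in> \<O> \<and> inverse (frac_embed u) \<in> \<O> \<and> frac_embed u \<noteq> 0"
    if u: "u dvd 1" for u :: 'r
  proof -
    obtain w where "1 = u * w"
      using u by (rule dvdE)
    then have *: "frac_embed u * frac_embed w = 1"
      by (metis frac_embed_1 frac_embed_mult)
    then have "inverse (frac_embed u) = frac_embed w"
      by (rule inverse_unique)
    with * show ?thesis
      by auto
  qed
  obtain a b where ab: "b \<noteq> 0" "x = frac_embed a / frac_embed b"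
    by (rule fract_eq_quotient)
  then have "a \<noteq> 0"
    using assms by auto
  obtain u n where u: "u dvd 1" "a = u * p ^ n"
    using unit_power_decomposition[OF \<open>a \<noteq> 0\<close>] .
  obtain w m where w: "w dvd 1" "b = w * p ^ m"
    using unit_power_decomposition[OF \<open>b \<noteq> 0\<close>] .
  show thesis
  proof (rule that)
    show "frac_embed u / frac_embed w \<in> \<O>" "inverse (frac_embed u / frac_embed w) \<in> \<O>"
      "frac_embed u / frac_embed w \<noteq> 0"
      using unit[OF u(1)] unit[OF w(1)] by (auto simp: divide_inverse intro: O_mult)
    show "x = frac_embed u / frac_embed w * P powi (int n - int m)"
      by (simp add: ab(2) u(2) w(2) frac_embed_mult frac_embed_power power_int_diff)
  qed
qed

text \<open>Locality inside the field: of the exponent in \<open>x = u * P powi k\<close>, the first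
  hypothesis gives \<open>k \<ge> 0\<close> and the second \<open>k < 1\<close>.\<close>

lemma inverse_in_O:
  assumes "x \<in> \<O>" "x * inverse P \<notin> \<O>"
  shows "inverse x \<in> \<O>"
proof -
  have "x \<noteq> 0"
    using assms by auto
  then obtain u k where u: "u \<in> \<O>" "inverse u \<in> \<O>" "u \<noteq> 0" "x = u * P powi k"
    by (rule fract_decomposition)
  have "P powi k \<in> \<O>"
    using O_mult[OF u(2) assms(1)] u(3) unfolding u(4) by (simp flip: mult.assoc)
  moreover have "\<not> k \<ge> 1"
  proof
    assume "k \<ge> 1"
    then have "u * P powi (k - 1) \<in> \<O>"
      using u by (intro O_mult) auto
    moreover have "u * P powi (k - 1) = x * inverse P"
      unfolding u(4) by (simp add: power_int_diff divide_inverse)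
    ultimately show False
      using assms(2) by simp
  qed
  ultimately have "k = 0"
    by simp
  then have "x = u"
    unfolding u(4) by simp
  then show ?thesis
    using u(2) by simp
qed

end

section \<open>Lattices given by bases\<close>

text \<open>The determinant of the two vectors. Its being nonzero stands for linear independence,
  over the field and, through \<open>rbasis_iff\<close>, over the ring.\<close>

definition wedge :: "'a::field ^ 2 \<Rightarrow> 'a ^ 2 \<Rightarrow> 'a" where
  "wedge e f = e $ 1 * f $ 2 - e $ 2 * f $ 1"

lemma vec2_eq_iff: "x = y \<longleftrightarrow> x $ 1 = y $ 1 \<and> x $ 2 = y $ 2" for x y :: "'a ^ 2"
  by (simp add: vec_eq_iff forall_2)

lemma wedge_scale: "wedge (a *s e) (b *s f) = a * b * wedge e f"
  by (simp add: wedge_def algebra_simps)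

lemma wedge_commute: "wedge f e = - wedge e f"
  by (simp add: wedge_def algebra_simps)

lemma wedge_coordinates:
  assumes "wedge e f \<noteq> 0"
  obtains a b where "x = a *s e + b *s f"
proof
  \<comment> \<open>Cramer's rule.\<close>
  show "x = (wedge x f / wedge e f) *s e + (wedge e x / wedge e f) *s f"
    using assms by (simp add: vec2_eq_iff field_simps) (simp add: wedge_def algebra_simps)
qed

lemma wedge_coordinates_unique:
  assumes "wedge e f \<noteq> 0" "a *s e + b *s f = c *s e + d *s f"
  shows "a = c" "b = d"
proof -
  have "(a - c) *s e + (b - d) *s f = 0"
    using assms(2) by (simp add: vec2_eq_iff algebra_simps)
  then have "(a - c) * e $ 1 + (b - d) * f $ 1 = 0" "(a - c) * e $ 2 + (b - d) * f $ 2 = 0"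
    by (simp_all add: vec2_eq_iff)
  then have "(a - c) * wedge e f = 0" "(b - d) * wedge e f = 0"
    unfolding wedge_def by algebra+
  then show "a = c" "b = d"
    using assms(1) by simp_all
qed

text \<open>This is \<open>rmod.span {e, f}\<close>, but with coefficients taken from the field, so
  that they can be compared with arbitrary coordinates and divided.\<close>

definition lattice_of :: "'r::idom fract ^ 2 \<Rightarrow> 'r fract ^ 2 \<Rightarrow> ('r fract ^ 2) set" where
  "lattice_of e f = {a *s e + b *s f | a b. a \<in> \<O> \<and> b \<in> \<O>}"

lemma lattice_of_commute: "lattice_of e f = lattice_of f e"
  by (auto simp: lattice_of_def intro: add.commute)

lemma span_eq_lattice_of: "rmod.span {e, f} = lattice_of e f"
proof (intro set_eqI iffI)
  fix x assume "x \<in> rmod.span {e, f}"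
  then obtain k l where "x - rscale k e = rscale l f"
    by (auto simp: rmod.span_insert[of e] rmod.span_singleton)
  then have "x = frac_embed k *s e + frac_embed l *s f"
    by (simp add: rscale_def algebra_simps)
  then show "x \<in> lattice_of e f"
    unfolding lattice_of_def using O_embed by blast
next
  fix x assume "x \<in> lattice_of e f"
  then obtain k l where "x = rscale k e + rscale l f"
    by (auto simp: lattice_of_def \<O>_def rscale_def)
  then show "x \<in> rmod.span {e, f}"
    by (simp add: rmod.span_add rmod.span_scale rmod.span_base)
qed

lemma rsubspace_O_scale: "rmod.subspace L \<Longrightarrow> a \<in> \<O> \<Longrightarrow> x \<in> L \<Longrightarrow> a *s x \<in> L"
  using rmod.subspace_scale[of L x] by (auto simp: \<O>_def rscale_def)

lemma rsubspace_lattice_of: "rmod.subspace (lattice_of e f)"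
  by (metis span_eq_lattice_of rmod.subspace_span)

lemma lattice_of_subset_iff:
  assumes "rmod.subspace L"
  shows "lattice_of e f \<subseteq> L \<longleftrightarrow> e \<in> L \<and> f \<in> L"
proof
  assume "e \<in> L \<and> f \<in> L"
  then show "lattice_of e f \<subseteq> L"
    using assms rmod.span_minimal[of "{e, f}" L] by (simp add: span_eq_lattice_of)
qed (use span_eq_lattice_of[of e f] rmod.span_superset[of "{e, f}"] in auto)

text \<open>Coordinates are unique, so membership decouples into two divisibility conditions.
  Lattices sharing a basis up to scaling are compared through this.\<close>

lemma mem_lattice_of_scaled_iff:
  assumes "wedge e f \<noteq> 0" "s \<noteq> 0" "t \<noteq> 0"
  shows "a *s e + b *s f \<in> lattice_of (s *s e) (t *s f) \<longleftrightarrow> a / s \<in> \<O> \<and> b / t \<in> \<O>"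
proof
  assume "a *s e + b *s f \<in> lattice_of (s *s e) (t *s f)"
  then obtain c d where "c \<in> \<O>" "d \<in> \<O>" "a *s e + b *s f = c *s (s *s e) + d *s (t *s f)"
    by (auto simp: lattice_of_def)
  moreover from this have "a = c * s" "b = d * t"
    using wedge_coordinates_unique[OF assms(1), of a b "c * s" "d * t"] by simp_all
  ultimately show "a / s \<in> \<O> \<and> b / t \<in> \<O>"
    using assms by simp
next
  assume "a / s \<in> \<O> \<and> b / t \<in> \<O>"
  moreover have "a *s e + b *s f = (a / s) *s (s *s e) + (b / t) *s (t *s f)"
    using assms by simp
  ultimately show "a *s e + b *s f \<in> lattice_of (s *s e) (t *s f)"
    unfolding lattice_of_def by blast
qed

text \<open>Clearing denominators in a relation over the field gives one over the ring. Hence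
  independence over the ring already forces a nonzero determinant.\<close>

lemma wedge_0_imp_relation:
  fixes e f :: "'r::idom fract ^ 2"
  assumes "wedge e f = 0"
  obtains a b where "rscale a e + rscale b f = 0" "a \<noteq> 0 \<or> b \<noteq> 0"
proof -
  obtain x y where xy: "x *s e + y *s f = 0" "x \<noteq> 0 \<or> y \<noteq> 0"
  proof (cases "e = 0 \<and> f = 0")
    case True
    then show ?thesis
      using that[of 1 1] by simp
  next
    case False
    then have "f $ 2 \<noteq> 0 \<or> - (e $ 2) \<noteq> 0 \<or> f $ 1 \<noteq> 0 \<or> - (e $ 1) \<noteq> 0"
      by (auto simp: vec2_eq_iff)
    \<comment> \<open>When the determinant vanishes, the coordinates of the vectors are themselves
      coefficients of relations; not all of them are zero.\<close>
    moreover have "f $ 2 *s e + (- (e $ 2)) *s f = 0" "f $ 1 *s e + (- (e $ 1)) *s f = 0"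
      using assms by (auto simp: vec2_eq_iff wedge_def algebra_simps)
    ultimately show ?thesis
      using that by metis
  qed
  obtain a b where ab: "b \<noteq> 0" "x = frac_embed a / frac_embed b"
    by (rule fract_eq_quotient)
  obtain c d where cd: "d \<noteq> 0" "y = frac_embed c / frac_embed d"
    by (rule fract_eq_quotient)
  have "rscale (a * d) e + rscale (c * b) f = (frac_embed b * frac_embed d) *s (x *s e + y *s f)"
    using ab cd by (simp add: rscale_def frac_embed_mult vec.scale_right_distrib mult.commute)
  then show thesis
    using that[of "a * d" "c * b"] ab cd xy by auto
qed

lemma rbasis_iff: "rbasis e f M \<longleftrightarrow> wedge e f \<noteq> 0 \<and> M = lattice_of e f"
proof (intro iffI conjI)
  assume M: "rbasis e f M"
  then show "M = lattice_of e f"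
    by (simp add: rbasis_def span_eq_lattice_of)
  show "wedge e f \<noteq> 0"
  proof
    assume "wedge e f = 0"
    then obtain a b where ab: "rscale a e + rscale b f = 0" "a \<noteq> 0 \<or> b \<noteq> 0"
      by (rule wedge_0_imp_relation)
    have "e \<noteq> f" "rmod.independent {e, f}"
      using M by (auto simp: rbasis_def)
    then show False
      using ab by (auto simp: rmod.dependent_finite dest!: spec[of _ "\<lambda>v. if v = e then a else b"])
  qed
next
  assume M: "wedge e f \<noteq> 0 \<and> M = lattice_of e f"
  then have ne: "e \<noteq> f"
    by (auto simp: wedge_def mult.commute)
  have "u e = 0 \<and> u f = 0" if "(\<Sum>v\<in>{e, f}. rscale (u v) v) = 0" for u
    using wedge_coordinates_unique[of e f "frac_embed (u e)" "frac_embed (u f)" 0 0] M that ne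
    by (simp add: rscale_def)
  then have "rmod.independent {e, f}"
    by (auto simp: rmod.dependent_finite)
  then show "rbasis e f M"
    using M ne by (simp add: rbasis_def span_eq_lattice_of)
qed

lemma is_lattice_lattice_of:
  assumes "wedge e f \<noteq> 0"
  shows "is_lattice (lattice_of e f)"
  unfolding is_lattice_def
proof (intro conjI)
  show "\<exists>B. finite B \<and> lattice_of e f = rmod.span B"
    by (metis finite.emptyI finite_insert span_eq_lattice_of)
  have ef: "{e, f} \<subseteq> lattice_of e f"
    using lattice_of_subset_iff[OF rsubspace_lattice_of, of e f e f] by simp
  show "vec.span (lattice_of e f) = UNIV"
  proof (intro set_eqI iffI UNIV_I)
    fix x
    obtain a b where "x = a *s e + b *s f"
      using wedge_coordinates[OF assms] .
    then show "x \<in> vec.span (lattice_of e f)"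
      using ef by (simp add: vec.span_add vec.span_scale vec.span_base)
  qed
qed (rule rsubspace_lattice_of)

lemma scale_lattice_of: "(\<lambda>x. \<alpha> *s x) ` lattice_of e f = lattice_of (\<alpha> *s e) (\<alpha> *s f)"
proof -
  have "\<alpha> *s (a *s e + b *s f) = a *s (\<alpha> *s e) + b *s (\<alpha> *s f)" for a b
    by (simp add: vec.scale_right_distrib mult.commute)
  then show ?thesis
    unfolding lattice_of_def by (auto simp: image_iff) metis+
qed

section \<open>Elementary divisors\<close>

text \<open>A downward closed set of integers without a greatest element is closed under successors
  as well, hence empty or everything.\<close>

lemma int_ex_greatest:
  fixes Q :: "int \<Rightarrow> bool"
  assumes "Q a" "\<not> Q b" and down: "\<And>k. Q (k + 1) \<Longrightarrow> Q k"
  obtains m where "Q m" "\<not> Q (m + 1)"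
proof (rule ccontr)
  assume "\<not> thesis"
  then have up: "Q (k + 1)" if "Q k" for k
    using that \<open>\<And>m. Q m \<Longrightarrow> \<not> Q (m + 1) \<Longrightarrow> thesis\<close> by blast
  have "Q b"
  proof (cases "a \<le> b")
    case True
    then show ?thesis
      by (induction rule: int_ge_induct) (use up \<open>Q a\<close> in auto)
  next
    case False
    then have "b \<le> a" by simp
    then show ?thesis
      by (induction rule: int_le_induct) (use down[of "_ - 1"] \<open>Q a\<close> in auto)
  qed
  then show False
    using \<open>\<not> Q b\<close> by contradiction
qed

lemma lattice_of_unit_scale:
  assumes "u \<in> \<O>" "inverse u \<in> \<O>" "u \<noteq> 0"
  shows "lattice_of (u *s e) (u *s f) = lattice_of e f"
proof -
  have sub: "lattice_of (u *s e) (u *s f) \<subseteq> lattice_of e f" if "u \<in> \<O>" for u and e f :: "'a fract ^ 2"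
    using lattice_of_subset_iff[OF rsubspace_lattice_of, of e f e f] that
    by (simp add: lattice_of_subset_iff rsubspace_lattice_of rsubspace_O_scale)
  show ?thesis
    using sub[of u e f] sub[of "inverse u" "u *s e" "u *s f"] assms by simp
qed

text \<open>The transition matrix has determinant \<open>- a\<close>, a unit. The new vector is put
  second, the position in which \<open>lattice_eq_if_primitive\<close> expects it.\<close>

lemma lattice_of_change_basis:
  assumes "a \<in> \<O>" "inverse a \<in> \<O>" "a \<noteq> 0" "b \<in> \<O>"
  shows "lattice_of f (a *s e + b *s f) = lattice_of e f"
proof
  have "e \<in> lattice_of e f" "f \<in> lattice_of e f"
    using lattice_of_subset_iff[OF rsubspace_lattice_of, of e f e f] by auto
  then show "lattice_of f (a *s e + b *s f) \<subseteq> lattice_of e f"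
    using assms
    by (simp add: lattice_of_subset_iff rsubspace_lattice_of rsubspace_O_scale rmod.subspace_add)
  let ?g = "a *s e + b *s f"
  have g: "f \<in> lattice_of f ?g" "?g \<in> lattice_of f ?g"
    using lattice_of_subset_iff[OF rsubspace_lattice_of, of f ?g f ?g] by auto
  have "e = inverse a *s (?g - b *s f)"
    using assms by simp
  moreover have "inverse a *s (?g - b *s f) \<in> lattice_of f ?g"
    using assms g by (intro rsubspace_O_scale rmod.subspace_diff rsubspace_lattice_of)
  ultimately show "lattice_of e f \<subseteq> lattice_of f ?g"
    using g by (simp add: lattice_of_subset_iff rsubspace_lattice_of)
qed

section \<open>Coordinates in a fixed basis and the elementary divisor theorem\<close>

context dvr
begin

text \<open>\<open>v\<close> is the valuation of \<open>x\<close>. The unit \<open>u\<close> does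
  not affect membership in \<open>\<O>\<close>, so \<open>x / P powi k\<close> behaves like
  \<open>P powi (v - k)\<close>.\<close>

lemma fract_valuation:
  assumes "x \<noteq> 0"
  obtains v u where "\<forall>k. x / P powi k \<in> \<O> \<longleftrightarrow> k \<le> v"
    "u \<in> \<O>" "inverse u \<in> \<O>" "u \<noteq> 0" "x = u * P powi v"
proof -
  obtain u v where u: "u \<in> \<O>" "inverse u \<in> \<O>" "u \<noteq> 0" "x = u * P powi v"
    using fract_decomposition[OF assms] .
  have "x / P powi k \<in> \<O> \<longleftrightarrow> k \<le> v" for k
  proof -
    have eq: "x / P powi k = u * P powi (v - k)"
      unfolding u(4) by (simp add: power_int_diff)
    have "u * P powi (v - k) \<in> \<O> \<longleftrightarrow> P powi (v - k) \<in> \<O>"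
      using O_mult[OF u(1), of "P powi (v - k)"] O_mult[OF u(2), of "u * P powi (v - k)"] u(3)
      by (auto simp flip: mult.assoc)
    then show ?thesis
      unfolding eq by simp
  qed
  then show thesis
    using that u by blast
qed

lemma inverse_P_not_in_O [simp]: "inverse P \<notin> \<O>"
  using P_powi_in_O_iff[of "- 1"] by (simp del: P_powi_in_O_iff)

lemma P_powi_divide: "P powi a / P powi b = P powi (a - b)"
  by (simp add: power_int_diff)

lemma wedge_powi_nonzero: "wedge e f \<noteq> 0 \<Longrightarrow> wedge (P powi n *s e) (P powi m *s f) \<noteq> 0"
  by (simp add: wedge_scale)

lemma mem_lattice_of_powi_iff:
  assumes "wedge e f \<noteq> 0"
  shows "a *s e + b *s f \<in> lattice_of (P powi n *s e) (P powi m *s f) \<longleftrightarrow>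
    a / P powi n \<in> \<O> \<and> b / P powi m \<in> \<O>"
  by (rule mem_lattice_of_scaled_iff[OF assms]) simp_all

lemma lattice_of_powi_subset_iff:
  assumes "wedge e f \<noteq> 0"
  shows "lattice_of (P powi a *s e) (P powi b *s f) \<subseteq> lattice_of (P powi c *s e) (P powi d *s f)
    \<longleftrightarrow> c \<le> a \<and> d \<le> b"
  using mem_lattice_of_powi_iff[OF assms, of "P powi a" 0 c d]
    mem_lattice_of_powi_iff[OF assms, of 0 "P powi b" c d]
  by (simp add: lattice_of_subset_iff rsubspace_lattice_of P_powi_divide)

text \<open>Finite generation bounds the denominators of the coordinates. The intermediate bounds
  hold for all \<open>j \<le> k\<close>, so that finitely many of them combine by
  \<open>min\<close>.\<close>

lemma lattice_subset_powi:
  assumes ef: "wedge e f \<noteq> 0" and L: "is_lattice L"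
  obtains k where "L \<subseteq> lattice_of (P powi k *s e) (P powi k *s f)"
proof -
  have coord: "\<exists>k. \<forall>j\<le>k. a / P powi j \<in> \<O>" for a
    by (cases "a = 0") (simp, metis fract_valuation)
  have elem: "\<exists>k. \<forall>j\<le>k. x \<in> lattice_of (P powi j *s e) (P powi j *s f)" for x
  proof -
    obtain a b where x: "x = a *s e + b *s f"
      using wedge_coordinates[OF ef] .
    obtain k l where "\<forall>j\<le>k. a / P powi j \<in> \<O>" "\<forall>j\<le>l. b / P powi j \<in> \<O>"
      using coord by meson
    then show ?thesis
      unfolding x mem_lattice_of_powi_iff[OF ef] by (intro exI[of _ "min k l"]) simp
  qed
  obtain B where B: "finite B" "L = rmod.span B"
    using L by (auto simp: is_lattice_def)
  from B(1) have "\<exists>k. \<forall>j\<le>k. B \<subseteq> lattice_of (P powi j *s e) (P powi j *s f)"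
  proof induction
    case (insert x B)
    then obtain k l where "\<forall>j\<le>k. B \<subseteq> lattice_of (P powi j *s e) (P powi j *s f)"
      "\<forall>j\<le>l. x \<in> lattice_of (P powi j *s e) (P powi j *s f)"
      using elem by meson
    then show ?case
      by (intro exI[of _ "min k l"]) simp
  qed simp
  then obtain k where "B \<subseteq> lattice_of (P powi k *s e) (P powi k *s f)"
    by auto
  then have "L \<subseteq> lattice_of (P powi k *s e) (P powi k *s f)"
    unfolding B(2) by (rule rmod.span_minimal) (rule rsubspace_lattice_of)
  then show thesis
    by (rule that)
qed

text \<open>A lattice on the line of \<open>f\<close> could not span the plane. While finite
  generation keeps a lattice from being too large, this keeps it from being too small.\<close>

lemma lattice_not_in_line:
  assumes ef: "wedge e f \<noteq> 0" and L: "is_lattice L"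
  obtains c d where "c *s e + d *s f \<in> L" "c \<noteq> 0"
proof (rule ccontr)
  assume "\<not> thesis"
  then have *: "c = 0" if "c *s e + d *s f \<in> L" for c d
    using that \<open>\<And>c d. c *s e + d *s f \<in> L \<Longrightarrow> c \<noteq> 0 \<Longrightarrow> thesis\<close> by blast
  have "L \<subseteq> vec.span {f}"
  proof
    fix x assume "x \<in> L"
    obtain c d where x: "x = c *s e + d *s f"
      using wedge_coordinates[OF ef] .
    then have "x = d *s f"
      using * \<open>x \<in> L\<close> by simp
    then show "x \<in> vec.span {f}"
      by (simp add: vec.span_scale vec.span_base)
  qed
  then have "vec.span L \<subseteq> vec.span {f}"
    by (rule vec.span_minimal) simp
  then have "e \<in> vec.span {f}"
    using L by (auto simp: is_lattice_def)
  then obtain d where "e = d *s f"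
    by (auto simp: vec.span_singleton)
  then show False
    using ef by (simp add: wedge_def mult.commute mult.left_commute)
qed

text \<open>All second coordinates in \<open>L\<close> are multiples of \<open>P powi m\<close>, and
  \<open>P powi m *s f\<close> lies in \<open>L\<close>, so this vector splits off: \<open>L\<close>
  is the sum of its multiples and of the intersection of \<open>L\<close> with the line of
  \<open>e\<close>. That intersection is generated by the lowest power of \<open>P\<close> times
  \<open>e\<close> lying in it.\<close>

lemma lattice_eq_if_primitive:
  assumes ef: "wedge e f \<noteq> 0" and L: "is_lattice L"
    and sub: "L \<subseteq> lattice_of (P powi m *s e) (P powi m *s f)"
    and f: "P powi m *s f \<in> L"
  obtains n where "n \<ge> m" "L = lattice_of (P powi n *s e) (P powi m *s f)"
proof -
  have subsp: "rmod.subspace L"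
    using L by (simp add: is_lattice_def)
  have coords: "c / P powi m \<in> \<O>" "d / P powi m \<in> \<O>" "c *s e \<in> L" if y: "c *s e + d *s f \<in> L" for c d
  proof -
    show c: "c / P powi m \<in> \<O>" and d: "d / P powi m \<in> \<O>"
      using sub y mem_lattice_of_powi_iff[OF ef, of c d m m] by auto
    have "(d / P powi m) *s (P powi m *s f) \<in> L"
      by (rule rsubspace_O_scale[OF subsp d f])
    then have "d *s f \<in> L"
      by simp
    then show "c *s e \<in> L"
      using rmod.subspace_diff[OF subsp y, of "d *s f"] by simp
  qed
  have coord1: "c / P powi m \<in> \<O>" if "c *s e \<in> L" for c
    using coords(1)[of c 0] that by simp
  have powi_up: "P powi b *s e \<in> L" if "P powi a *s e \<in> L" "a \<le> b" for a b
    using rsubspace_O_scale[OF subsp _ that(1), of "P powi (b - a)"] that(2)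
    by (simp flip: power_int_add)
  have powi: "\<exists>v. P powi v *s e \<in> L \<and> (\<forall>k\<le>v. c / P powi k \<in> \<O>)" if c: "c *s e \<in> L" "c \<noteq> 0" for c
  proof -
    obtain v u where v: "\<forall>k. c / P powi k \<in> \<O> \<longleftrightarrow> k \<le> v"
      "u \<in> \<O>" "inverse u \<in> \<O>" "u \<noteq> 0" "c = u * P powi v"
      using fract_valuation[OF c(2)] .
    have "inverse u *s (c *s e) \<in> L"
      by (rule rsubspace_O_scale[OF subsp v(3) c(1)])
    then have "P powi v *s e \<in> L"
      using v(4) unfolding v(5) by (simp flip: mult.assoc)
    then show ?thesis
      using v(1) by blast
  qed
  obtain c d where "c *s e + d *s f \<in> L" "c \<noteq> 0"
    using lattice_not_in_line[OF ef L] .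
  then obtain v where "P powi v *s e \<in> L"
    using coords(3) powi by blast
  moreover have "P powi (m - 1) *s e \<notin> L"
    using coord1[of "P powi (m - 1)"] by (auto simp: P_powi_divide)
  \<comment> \<open>The least exponent is wanted, hence the change of sign; \<open>1 - m\<close>
    stands for the exponent \<open>m - 1\<close>, which \<open>sub\<close> excludes.\<close>
  ultimately obtain k where k: "P powi (- k) *s e \<in> L" "P powi (- (k + 1)) *s e \<notin> L"
    using powi_up int_ex_greatest[of "\<lambda>k. P powi (- k) *s e \<in> L" "- v" "1 - m"] by auto
  define n where "n = - k"
  have n: "P powi n *s e \<in> L" "P powi (n - 1) *s e \<notin> L"
    using k by (simp_all add: n_def)
  have "n \<ge> m"
    using coord1[OF n(1)] by (simp add: P_powi_divide)
  moreover have "L \<subseteq> lattice_of (P powi n *s e) (P powi m *s f)"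
  proof
    fix y assume y: "y \<in> L"
    obtain c d where cd: "y = c *s e + d *s f"
      using wedge_coordinates[OF ef] .
    have "c / P powi n \<in> \<O>"
    proof (cases "c = 0")
      case False
      then obtain v where v: "P powi v *s e \<in> L" "\<forall>k\<le>v. c / P powi k \<in> \<O>"
        using powi coords(3) y cd by blast
      then have "n \<le> v"
        using powi_up[of v "n - 1"] n(2) by force
      then show ?thesis
        using v by blast
    qed simp
    then show "y \<in> lattice_of (P powi n *s e) (P powi m *s f)"
      using coords(2) y cd mem_lattice_of_powi_iff[OF ef] by blast
  qed
  moreover have "lattice_of (P powi n *s e) (P powi m *s f) \<subseteq> L"
    using n f by (simp add: lattice_of_subset_iff subsp)
  ultimately show thesis
    using that by blast
qed

text \<open>The conditions on \<open>a\<close> make it a unit, so \<open>f\<close> and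
  \<open>a *s e + b *s f\<close> form another basis of the same lattice, and the second of these
  vectors can be split off. The case of a unit \<open>b\<close> follows by interchanging
  \<open>e\<close> and \<open>f\<close>.\<close>

lemma lattice_elementary_divisors_aux:
  assumes ef: "wedge e f \<noteq> 0" and L: "is_lattice L"
    and sub: "L \<subseteq> lattice_of (P powi m *s e) (P powi m *s f)"
    and x: "P powi m *s (a *s e + b *s f) \<in> L"
    and ab: "a \<in> \<O>" "b \<in> \<O>" "a * inverse P \<notin> \<O>"
  obtains e' f' n m where "n \<ge> m" "wedge e' f' \<noteq> 0" "lattice_of e' f' = lattice_of e f"
    "L = lattice_of (P powi n *s e') (P powi m *s f')"
proof -
  define g where "g = a *s e + b *s f"
  have a: "a \<noteq> 0" "inverse a \<in> \<O>"
    using ab inverse_in_O by auto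
  have "wedge f g = - a * wedge e f"
    unfolding g_def wedge_def by (simp add: algebra_simps)
  then have wedge: "wedge f g \<noteq> 0"
    using a ef by simp
  have fg: "lattice_of f g = lattice_of e f"
    unfolding g_def using a ab by (intro lattice_of_change_basis)
  then have "L \<subseteq> lattice_of (P powi m *s f) (P powi m *s g)"
    using sub by (simp flip: scale_lattice_of)
  then show thesis
    using lattice_eq_if_primitive[OF wedge L _ x[folded g_def]] that[OF _ wedge fg] by blast
qed

text \<open>Let \<open>m\<close> be the greatest exponent with \<open>L\<close> inside
  \<open>p ^ m M\<close>. A vector of \<open>L\<close> outside \<open>p ^ (m + 1) M\<close> is
  \<open>p ^ m\<close> times one with a unit coordinate.\<close>

lemma lattice_elementary_divisors:
  assumes ef: "wedge e f \<noteq> 0" and L: "is_lattice L"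
  obtains e' f' n m where "n \<ge> m" "wedge e' f' \<noteq> 0" "lattice_of e' f' = lattice_of e f"
    "L = lattice_of (P powi n *s e') (P powi m *s f')"
proof -
  define M where "M k = lattice_of (P powi k *s e) (P powi k *s f)" for k
  obtain k0 where k0: "L \<subseteq> M k0"
    using lattice_subset_powi[OF ef L] unfolding M_def .
  obtain c d where cd: "c *s e + d *s f \<in> L" "c \<noteq> 0"
    using lattice_not_in_line[OF ef L] .
  obtain v where "\<forall>k. c / P powi k \<in> \<O> \<longleftrightarrow> k \<le> v"
    using fract_valuation[OF cd(2)] by blast
  \<comment> \<open>The valuation \<open>v\<close> of a nonzero first coordinate occurring in
    \<open>L\<close> bounds the possible exponents from above.\<close>
  then have "\<not> L \<subseteq> M (v + 1)"
    using cd(1) mem_lattice_of_powi_iff[OF ef, of c d "v + 1" "v + 1"] by (auto simp: M_def)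
  moreover have "M (k + 1) \<subseteq> M k" for k
    using lattice_of_powi_subset_iff[OF ef] by (simp add: M_def)
  ultimately obtain m where m: "L \<subseteq> M m" "\<not> L \<subseteq> M (m + 1)"
    using int_ex_greatest[of "\<lambda>k. L \<subseteq> M k", OF k0] by blast
  then obtain x where x: "x \<in> L" "x \<in> M m" "x \<notin> M (m + 1)"
    by blast
  obtain c d where cd: "x = c *s e + d *s f"
    using wedge_coordinates[OF ef] .
  define a b where "a = c / P powi m" and "b = d / P powi m"
  have ab: "a \<in> \<O>" "b \<in> \<O>"
    using x(2) unfolding cd M_def mem_lattice_of_powi_iff[OF ef] a_def b_def by simp_all
  have xab: "x = P powi m *s (a *s e + b *s f)"
    by (simp add: cd a_def b_def vec.scale_right_distrib)
  have "c / P powi (m + 1) = a * inverse P" "d / P powi (m + 1) = b * inverse P"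
    by (simp_all add: a_def b_def power_int_add divide_inverse)
  then consider "a * inverse P \<notin> \<O>" | "b * inverse P \<notin> \<O>"
    using x(3) unfolding cd M_def mem_lattice_of_powi_iff[OF ef] by auto
  then show thesis
  proof cases
    case 1
    show ?thesis
      by (rule lattice_elementary_divisors_aux[OF ef L m(1)[unfolded M_def] x(1)[unfolded xab] ab 1])
        (rule that)
  next
    case 2
    have fe: "wedge f e \<noteq> 0"
      using ef by (simp add: wedge_commute[of e])
    have sub: "L \<subseteq> lattice_of (P powi m *s f) (P powi m *s e)"
      using m(1) by (simp add: M_def lattice_of_commute)
    have mem: "P powi m *s (b *s f + a *s e) \<in> L"
      using x(1) unfolding xab by (simp add: add.commute)
    show ?thesis
      by (rule lattice_elementary_divisors_aux[OF fe L sub mem ab(2,1) 2, unfolded lattice_of_commute[of f e]])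
        (rule that)
  qed
qed

end

section \<open>Relative exponents and distance\<close>

context dvr
begin

text \<open>Elementary divisors relative to the standard lattice exhibit a basis, so freeness is a
  by-product.\<close>

lemma is_lattice_iff: "is_lattice L \<longleftrightarrow> (\<exists>e f :: 'r fract ^ 2. wedge e f \<noteq> 0 \<and> L = lattice_of e f)"
proof
  assume L: "is_lattice L"
  have "wedge (axis 1 1) (axis 2 1 :: 'r fract ^ 2) \<noteq> 0"
    by (simp add: wedge_def axis_def)
  then show "\<exists>e f. wedge e f \<noteq> 0 \<and> L = lattice_of e f"
    using lattice_elementary_divisors[OF _ L] wedge_powi_nonzero by metis
qed (auto intro: is_lattice_lattice_of)

lemma relative_exponents_iff:
  "relative_exponents p M L (n, m) \<longleftrightarrow> m \<le> n \<and>
    (\<exists>e f. wedge e f \<noteq> 0 \<and> M = lattice_of e f \<and> L = lattice_of (P powi n *s e) (P powi m *s f))"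
  using wedge_powi_nonzero unfolding relative_exponents_def rbasis_iff split by blast

lemma ex_relative_exponents:
  assumes "is_lattice M" "is_lattice L"
  obtains n m where "relative_exponents p M L (n, m)"
proof -
  obtain e f where ef: "wedge e f \<noteq> 0" "M = lattice_of e f"
    using assms(1) by (auto simp: is_lattice_iff)
  obtain e' f' n m where "m \<le> n" "wedge e' f' \<noteq> 0" "lattice_of e' f' = lattice_of e f"
    "L = lattice_of (P powi n *s e') (P powi m *s f')"
    using lattice_elementary_divisors[OF ef(1) assms(2)] .
  then have "relative_exponents p M L (n, m)"
    using ef(2) unfolding relative_exponents_iff by metis
  then show thesis
    by (rule that)
qed

lemma relative_exponents_subset_iff:
  assumes "relative_exponents p M L (n, m)"
  shows "L \<subseteq> (\<lambda>x. P powi k *s x) ` M \<longleftrightarrow> k \<le> m"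
    and "(\<lambda>x. P powi k *s x) ` M \<subseteq> L \<longleftrightarrow> n \<le> k"
proof -
  obtain e f where ef: "m \<le> n" "wedge e f \<noteq> 0" "M = lattice_of e f"
    "L = lattice_of (P powi n *s e) (P powi m *s f)"
    using assms by (auto simp: relative_exponents_iff)
  then show "L \<subseteq> (\<lambda>x. P powi k *s x) ` M \<longleftrightarrow> k \<le> m" "(\<lambda>x. P powi k *s x) ` M \<subseteq> L \<longleftrightarrow> n \<le> k"
    by (auto simp: scale_lattice_of lattice_of_powi_subset_iff)
qed

lemma relative_exponents_unique:
  assumes "relative_exponents p M L (n, m)" "relative_exponents p M L (n', m')"
  shows "n' = n" "m' = m"
proof -
  have "k \<le> m \<longleftrightarrow> k \<le> m'" "n \<le> k \<longleftrightarrow> n' \<le> k" for k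
    using relative_exponents_subset_iff[OF assms(1), of k]
      relative_exponents_subset_iff[OF assms(2), of k] by simp_all
  then show "n' = n" "m' = m"
    by (meson order_antisym order_refl)+
qed

lemma lattice_dist_eq:
  assumes "relative_exponents p M L (n, m)"
  shows "lattice_dist p M L = n - m"
proof -
  have "(THE nm. relative_exponents p M L nm) = (n, m)"
  proof (rule the_equality)
    fix nm assume "relative_exponents p M L nm"
    then show "nm = (n, m)"
      using relative_exponents_unique[OF assms] by (cases nm) blast
  qed (rule assms)
  then show ?thesis
    by (simp add: lattice_dist_def)
qed

text \<open>The two basis vectors are interchanged because negation reverses the order of the
  exponents.\<close>

lemma relative_exponents_sym:
  assumes "relative_exponents p M L (n, m)"
  shows "relative_exponents p L M (- m, - n)"
proof -
  obtain e f where ef: "m \<le> n" "wedge e f \<noteq> 0" "M = lattice_of e f"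
    "L = lattice_of (P powi n *s e) (P powi m *s f)"
    using assms by (auto simp: relative_exponents_iff)
  have "wedge (P powi m *s f) (P powi n *s e) \<noteq> 0"
    using ef(2) wedge_commute[of e f] by (intro wedge_powi_nonzero) simp
  moreover have "M = lattice_of (P powi (- m) *s (P powi m *s f)) (P powi (- n) *s (P powi n *s e))"
    using ef(3) lattice_of_commute[of e f] by (simp flip: power_int_add)
  moreover have "L = lattice_of (P powi m *s f) (P powi n *s e)"
    using ef(4) by (simp add: lattice_of_commute)
  ultimately show ?thesis
    using ef(1) unfolding relative_exponents_iff neg_le_iff_le by blast
qed

section \<open>Invariance under homothety\<close>

lemma scale_lattice_of_powi:
  assumes "\<alpha> \<noteq> 0"
  obtains k where "\<And>e f. (\<lambda>x. \<alpha> *s x) ` lattice_of e f = lattice_of (P powi k *s e) (P powi k *s f)"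
proof -
  obtain u k where u: "u \<in> \<O>" "inverse u \<in> \<O>" "u \<noteq> 0" "\<alpha> = u * P powi k"
    using fract_decomposition[OF assms] .
  have "(\<lambda>x. \<alpha> *s x) ` lattice_of e f = lattice_of (P powi k *s e) (P powi k *s f)" for e f
    using lattice_of_unit_scale[OF u(1-3), of "P powi k *s e" "P powi k *s f"]
    by (simp add: scale_lattice_of u(4))
  then show thesis
    by (rule that)
qed

text \<open>Only the valuations \<open>a\<close> and \<open>b\<close> of the two scalars matter;
  both exponents change by \<open>b - a\<close>, which cancels in their difference.\<close>

lemma lattice_dist_scale:
  assumes "is_lattice M" "is_lattice L" "\<alpha> \<noteq> 0" "\<beta> \<noteq> 0"
  shows "lattice_dist p ((\<lambda>x. \<alpha> *s x) ` M) ((\<lambda>x. \<beta> *s x) ` L) = lattice_dist p M L"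
proof -
  obtain n m where nm: "relative_exponents p M L (n, m)"
    using ex_relative_exponents[OF assms(1,2)] .
  then obtain e f where ef: "m \<le> n" "wedge e f \<noteq> 0" "M = lattice_of e f"
    "L = lattice_of (P powi n *s e) (P powi m *s f)"
    by (auto simp: relative_exponents_iff)
  obtain a where a: "\<And>e f. (\<lambda>x. \<alpha> *s x) ` lattice_of e f = lattice_of (P powi a *s e) (P powi a *s f)"
    using scale_lattice_of_powi[OF assms(3)] by blast
  obtain b where b: "\<And>e f. (\<lambda>x. \<beta> *s x) ` lattice_of e f = lattice_of (P powi b *s e) (P powi b *s f)"
    using scale_lattice_of_powi[OF assms(4)] by blast
  have "relative_exponents p ((\<lambda>x. \<alpha> *s x) ` M) ((\<lambda>x. \<beta> *s x) ` L) (n + b - a, m + b - a)"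
    unfolding relative_exponents_iff
  proof (intro conjI exI)
    show "wedge (P powi a *s e) (P powi a *s f) \<noteq> 0"
      using ef(2) by (rule wedge_powi_nonzero)
    show "(\<lambda>x. \<beta> *s x) ` L =
        lattice_of (P powi (n + b - a) *s (P powi a *s e)) (P powi (m + b - a) *s (P powi a *s f))"
      unfolding ef(4) b by (simp add: add.commute flip: power_int_add)
  qed (use ef a in simp_all)
  then show ?thesis
    using lattice_dist_eq nm by simp
qed

lemma is_lattice_scale:
  fixes M :: "('r fract ^ 2) set"
  assumes "is_lattice M" "\<alpha> \<noteq> 0"
  shows "is_lattice ((\<lambda>x. \<alpha> *s x) ` M)"
proof -
  obtain e f :: "'r fract ^ 2" where "wedge e f \<noteq> 0" "M = lattice_of e f"
    using assms(1) by (auto simp: is_lattice_iff)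
  then show ?thesis
    using assms(2) by (simp add: scale_lattice_of is_lattice_lattice_of wedge_scale)
qed

text \<open>The definition scales the second lattice; with the inverse scalar, the class of
  \<open>M\<close> becomes the set of multiples of \<open>M\<close>.\<close>

lemma homothety_iff:
  fixes M :: "('r fract ^ 2) set"
  assumes "is_lattice M"
  shows "(M, L) \<in> homothety \<longleftrightarrow> (\<exists>\<alpha>. \<alpha> \<noteq> 0 \<and> L = (\<lambda>x. \<alpha> *s x) ` M)"
proof (intro iffI)
  assume "(M, L) \<in> homothety"
  then obtain \<alpha> where "\<alpha> \<noteq> 0" "M = (\<lambda>x. \<alpha> *s x) ` L"
    by (auto simp: homothety_def)
  then show "\<exists>\<alpha>. \<alpha> \<noteq> 0 \<and> L = (\<lambda>x. \<alpha> *s x) ` M"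
    by (intro exI[of _ "inverse \<alpha>"]) (simp add: image_image)
next
  assume "\<exists>\<alpha>. \<alpha> \<noteq> 0 \<and> L = (\<lambda>x. \<alpha> *s x) ` M"
  then obtain \<alpha> where \<alpha>: "\<alpha> \<noteq> 0" "L = (\<lambda>x. \<alpha> *s x) ` M"
    by blast
  then have "M = (\<lambda>x. inverse \<alpha> *s x) ` L"
    by (simp add: image_image)
  then show "(M, L) \<in> homothety"
    using \<alpha> assms is_lattice_scale unfolding homothety_def
    by (auto intro!: exI[of _ "inverse \<alpha>"])
qed

lemma homothety_refl: "is_lattice M \<Longrightarrow> (M, M) \<in> homothety"
  by (auto simp: homothety_def intro!: exI[of _ 1])

lemma vertex_dist_eq:
  assumes "is_lattice M" "is_lattice L"
  shows "vertex_dist p (homothety `` {M}) (homothety `` {L}) = lattice_dist p M L"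
proof -
  have eq: "lattice_dist p M' L' = lattice_dist p M L"
    if "M' \<in> homothety `` {M}" "L' \<in> homothety `` {L}" for M' L'
    using that assms lattice_dist_scale by (auto simp: homothety_iff)
  show ?thesis
    unfolding vertex_dist_def
  proof (rule the_equality)
    have "M \<in> homothety `` {M}" "L \<in> homothety `` {L}"
      using assms by (simp_all add: homothety_refl)
    then show "\<exists>M'\<in>homothety `` {M}. \<exists>L'\<in>homothety `` {L}. lattice_dist p M L = lattice_dist p M' L'"
      by blast
  qed (use eq in blast)
qed

lemma homothety_class_scale:
  fixes M :: "('r fract ^ 2) set"
  assumes "is_lattice M" "\<alpha> \<noteq> 0"
  shows "homothety `` {(\<lambda>x. \<alpha> *s x) ` M} = homothety `` {M}"
proof -
  have "(\<exists>\<beta>. \<beta> \<noteq> 0 \<and> L = (\<lambda>x. \<beta> *s x) ` (\<lambda>x. \<alpha> *s x) ` M) \<longleftrightarrow> (\<exists>\<beta>. \<beta> \<noteq> 0 \<and> L = (\<lambda>x. \<beta> *s x) ` M)" for L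
  proof (intro iffI; elim exE conjE)
    fix \<beta> :: "'r fract" assume "\<beta> \<noteq> 0" "L = (\<lambda>x. \<beta> *s x) ` (\<lambda>x. \<alpha> *s x) ` M"
    then show "\<exists>\<beta>. \<beta> \<noteq> 0 \<and> L = (\<lambda>x. \<beta> *s x) ` M"
      using assms(2) by (intro exI[of _ "\<beta> * \<alpha>"]) (simp add: image_image)
  next
    fix \<beta> :: "'r fract" assume "\<beta> \<noteq> 0" "L = (\<lambda>x. \<beta> *s x) ` M"
    then show "\<exists>\<beta>. \<beta> \<noteq> 0 \<and> L = (\<lambda>x. \<beta> *s x) ` (\<lambda>x. \<alpha> *s x) ` M"
      using assms(2) by (intro exI[of _ "\<beta> / \<alpha>"]) (simp add: image_image)
  qed
  then show ?thesis
    unfolding set_eq_iff Image_singleton_iff homothety_iff[OF is_lattice_scale[OF assms]]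
      homothety_iff[OF assms(1)] by (rule allI)
qed

lemma relative_exponents_scale:
  assumes "relative_exponents p M L (n, m)"
  shows "relative_exponents p M ((\<lambda>x. P powi k *s x) ` L) (n + k, m + k)"
proof -
  obtain e f where ef: "m \<le> n" "wedge e f \<noteq> 0" "M = lattice_of e f"
    "L = lattice_of (P powi n *s e) (P powi m *s f)"
    using assms by (auto simp: relative_exponents_iff)
  then show ?thesis
    unfolding relative_exponents_iff
    by (intro conjI exI[of _ e] exI[of _ f])
      (simp_all add: scale_lattice_of power_int_add mult.commute)
qed

lemma relative_exponents_refl:
  assumes "is_lattice M"
  shows "relative_exponents p M M (0, 0)"
  using assms by (auto simp: is_lattice_iff relative_exponents_iff)

end

section \<open>An acyclicity criterion\<close>

lemma pcas_imp_arcs_closed_walk: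
  assumes "pcas u c v" "i < length c"
  shows "c ! i = (if i = 0 then u else snd (c ! (i - 1)), snd (c ! i))"
  using assms
proof (induction c arbitrary: u i)
  case (Cons e c)
  then show ?case
    by (cases i) (auto simp: nth_Cons' prod_eq_iff)
qed simp

lemma pcas_last: "pcas u c v \<Longrightarrow> c \<noteq> [] \<Longrightarrow> snd (last c) = v"
  by (induction c arbitrary: u) (auto split: if_splits)

lemma tl_pawalk_verts: "pcas u c v \<Longrightarrow> tl (pawalk_verts u c) = map snd c"
proof (induction c arbitrary: u)
  case (Cons e c)
  then show ?case
    by (cases c) auto
qed simp

text \<open>A vertex of maximal height on a cycle would be adjacent to two vertices that are no
  higher than itself.\<close>

lemma acyclic_graph_if_unique_parent:
  fixes h :: "'a \<Rightarrow> int"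
  assumes sym: "\<And>v w. (v, w) \<in> parcs G \<Longrightarrow> (w, v) \<in> parcs G"
    and parent: "\<And>v w w'. \<lbrakk>(v, w) \<in> parcs G; (v, w') \<in> parcs G; h w \<le> h v; h w' \<le> h v\<rbrakk> \<Longrightarrow> w = w'"
  shows "acyclic_graph G"
  unfolding acyclic_graph_def
proof
  assume "\<exists>c. pre_digraph.cycle (with_proj G) c \<and> length c \<ge> 3"
  then obtain c u where c: "length c \<ge> 3" "set c \<subseteq> parcs G" "pcas u c u"
    "distinct (tl (pawalk_verts u c))"
    by (auto simp: pre_digraph.cycle_def pre_digraph.awalk_def cas_with_proj_eq
        awalk_verts_with_proj_eq)
  \<comment> \<open>A closed walk is described by the heads of its arcs. Dropping the starting
    vertex, which recurs at the end, leaves exactly these heads, so they are distinct.\<close>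
  define x where "x i = snd (c ! i)" for i
  define n where "n = length c"
  have n: "n \<ge> 3"
    using c(1) by (simp add: n_def)
  have inj: "i = j" if "x i = x j" "i < n" "j < n" for i j
    using c(4) that unfolding tl_pawalk_verts[OF c(3)]
    by (simp add: x_def n_def distinct_conv_nth) metis
  define pred where "pred i = (if i = 0 then n - 1 else i - 1)" for i
  have "x (n - 1) = u"
    using pcas_last[OF c(3)] c(1) by (simp add: x_def n_def last_conv_nth flip: length_greater_0_conv)
  then have arc: "(x (pred i), x i) \<in> parcs G" if "i < n" for i
    using pcas_imp_arcs_closed_walk[OF c(3), of i] c(2) that nth_mem[of i c]
    by (auto simp: x_def pred_def n_def split: if_splits)
  obtain j where j: "j < n" "\<And>i. i < n \<Longrightarrow> h (x i) \<le> h (x j)"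
  proof -
    have fin: "finite ((\<lambda>i. h (x i)) ` {..<n})" "(\<lambda>i. h (x i)) ` {..<n} \<noteq> {}"
      using n by (auto simp: lessThan_empty_iff)
    obtain j where "j < n" "h (x j) = Max ((\<lambda>i. h (x i)) ` {..<n})"
      using Max_in[OF fin] by auto
    then show ?thesis
      using that Max_ge[OF fin(1)] by simp
  qed
  \<comment> \<open>The cyclic successor of \<open>j\<close>. It differs from the predecessor
    because the cycle has at least three arcs.\<close>
  define k where "k = (if j = n - 1 then 0 else Suc j)"
  have k: "k < n" "pred k = j" "pred j < n" "pred j \<noteq> k"
    using j(1) n by (auto simp: k_def pred_def)
  have "(x j, x (pred j)) \<in> parcs G" "(x j, x k) \<in> parcs G"
    using sym[OF arc[OF j(1)]] arc[OF k(1)] k(2) by simp_all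
  then have "x (pred j) = x k"
    using parent j(2)[OF k(3)] j(2)[OF k(1)] by blast
  then show False
    using inj k by blast
qed

section \<open>The Bruhat--Tits tree\<close>

context dvr
begin

lemma vertexE:
  assumes "v \<in> homothety_classes"
  obtains L :: "('r fract ^ 2) set" where "is_lattice L" "v = homothety `` {L}"
  using assms by (auto simp: homothety_classes_def quotient_def)

lemma class_is_vertex: "is_lattice L \<Longrightarrow> homothety `` {L} \<in> homothety_classes"
  by (auto simp: homothety_classes_def quotient_def)

lemma parcs_bruhat_tits_graph:
  "(v, w) \<in> parcs (bruhat_tits_graph p) \<longleftrightarrow>
    v \<in> homothety_classes \<and> w \<in> homothety_classes \<and> vertex_dist p v w = 1"
  by (simp add: bruhat_tits_graph_def)

lemma pverts_bruhat_tits_graph: "pverts (bruhat_tits_graph p) = homothety_classes"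
  by (simp add: bruhat_tits_graph_def)

lemma ex_vertex: "(homothety_classes :: ('r fract ^ 2) set set set) \<noteq> {}"
proof -
  have "is_lattice (lattice_of (axis 1 1) (axis 2 1 :: 'r fract ^ 2))"
    by (intro is_lattice_lattice_of) (simp add: wedge_def axis_def)
  then show ?thesis
    using class_is_vertex by blast
qed

text \<open>Scaling by \<open>P powi (- m)\<close> makes the lower exponent 0: this representative
  lies in \<open>M\<close> but not in \<open>p M\<close>.\<close>

lemma normalised_representative:
  assumes "is_lattice M" "is_lattice L"
  obtains L' where "is_lattice L'" "homothety `` {L'} = homothety `` {L}"
    "relative_exponents p M L' (lattice_dist p M L, 0)"
proof -
  obtain n m where nm: "relative_exponents p M L (n, m)"
    using ex_relative_exponents[OF assms] .
  show thesis
  proof (rule that)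
    show "relative_exponents p M ((\<lambda>x. P powi (- m) *s x) ` L) (lattice_dist p M L, 0)"
      using relative_exponents_scale[OF nm, of "- m"] lattice_dist_eq[OF nm] by simp
  qed (simp_all add: assms is_lattice_scale homothety_class_scale)
qed

lemma lattice_dist_sym:
  assumes "is_lattice M" "is_lattice L"
  shows "lattice_dist p M L = lattice_dist p L M"
proof -
  obtain n m where nm: "relative_exponents p M L (n, m)"
    using ex_relative_exponents[OF assms] .
  then show ?thesis
    using lattice_dist_eq[OF nm] lattice_dist_eq[OF relative_exponents_sym[OF nm]] by simp
qed

text \<open>A neighbour of \<open>L\<close> corresponds to a line in the plane
  \<open>L / p L\<close> over the residue field, and the claim is that this line is spanned by
  \<open>P powi n *s e\<close>. On any other line there is a vector whose
  \<open>f\<close>-coordinate is a unit; the distance bound puts \<open>P powi n *s e\<close> into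
  \<open>L'\<close> as well, so \<open>f\<close> and then all of \<open>L\<close> would lie in
  \<open>L'\<close>.\<close>

lemma parent_eq:
  assumes "is_lattice M" and L': "is_lattice L'"
    and L: "relative_exponents p M L (n, 0)" and LL': "relative_exponents p L L' (1, 0)"
    and dist: "lattice_dist p M L' \<le> n"
  shows "L' = L \<inter> (\<lambda>x. P *s x) ` M"
proof -
  obtain e f where ef: "n \<ge> 0" "wedge e f \<noteq> 0" "M = lattice_of e f" "L = lattice_of (P powi n *s e) f"
    using L by (auto simp: relative_exponents_iff)
  have subsp: "rmod.subspace L'"
    using L' by (simp add: is_lattice_def)
  have PM: "(\<lambda>x. P *s x) ` M = lattice_of (P powi 1 *s e) (P powi 1 *s f)"
    by (simp add: ef(3) scale_lattice_of)
  have PL: "(\<lambda>x. P *s x) ` L = lattice_of (P powi (n + 1) *s e) (P powi 1 *s f)"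
    by (simp add: ef(4) scale_lattice_of power_int_add mult.commute)
  have L_sub: "L' \<subseteq> L" "(\<lambda>x. P *s x) ` L \<subseteq> L'" "\<not> L \<subseteq> L'" "\<not> L' \<subseteq> (\<lambda>x. P *s x) ` L"
    using relative_exponents_subset_iff[OF LL', of 0] relative_exponents_subset_iff[OF LL', of 1]
    by simp_all
  then have Pf: "P *s f \<in> L'"
    unfolding PL by (simp add: lattice_of_subset_iff subsp)
  have L_coords: "\<exists>a b. a \<in> \<O> \<and> b \<in> \<O> \<and> x = (a * P powi n) *s e + b *s f" if "x \<in> L" for x
    using that by (auto simp: ef(4) lattice_of_def)
  have L'_f: "b *s f \<in> L'" if "b / P \<in> \<O>" for b
    using rsubspace_O_scale[OF subsp that Pf] by simp
  have L_sub_M: "L \<subseteq> M"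
    using relative_exponents_subset_iff(1)[OF L, of 0] by simp
  obtain n' m' where nm': "relative_exponents p M L' (n', m')"
    using ex_relative_exponents[OF assms(1) L'] .
  have L'_PM: "L' \<subseteq> (\<lambda>x. P *s x) ` M"
  proof (rule ccontr)
    assume not_sub: "\<not> L' \<subseteq> (\<lambda>x. P *s x) ` M"
    then obtain x where x: "x \<in> L'" "x \<notin> (\<lambda>x. P *s x) ` M"
      by blast
    \<comment> \<open>\<open>L'\<close> lies in \<open>M\<close> but not in \<open>p M\<close>,
      which fixes the lower exponent and turns the distance bound into a bound on
      \<open>n'\<close>.\<close>
    have "m' = 0"
      using relative_exponents_subset_iff(1)[OF nm', of 0] relative_exponents_subset_iff(1)[OF nm', of 1]
        L_sub(1) L_sub_M not_sub by auto
    then have "n' \<le> n"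
      using dist lattice_dist_eq[OF nm'] by simp
    then have "lattice_of (P powi n *s e) (P powi n *s f) \<subseteq> L'"
      using relative_exponents_subset_iff(2)[OF nm', of n] by (simp add: ef(3) scale_lattice_of)
    then have Pn: "P powi n *s e \<in> L'" "P powi n *s f \<in> L'"
      by (simp_all add: lattice_of_subset_iff subsp)
    have "f \<notin> L'"
      using L_sub(3) Pn(1) by (simp add: ef(4) lattice_of_subset_iff subsp)
    \<comment> \<open>For \<open>n = 0\<close> the vector \<open>P powi n *s f\<close> is
      \<open>f\<close> itself. Once \<open>n \<ge> 1\<close>, the \<open>e\<close>-part of
      \<open>x\<close> lies in \<open>p M\<close>, so \<open>b\<close> must be responsible for
      \<open>x\<close> lying outside.\<close>
    then have "n \<ge> 1"
      using Pn(2) ef(1) by (cases "n = 0") auto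
    obtain a b where ab: "a \<in> \<O>" "b \<in> \<O>" "x = (a * P powi n) *s e + b *s f"
      using L_coords x(1) L_sub(1) by blast
    have "a * P powi (n - 1) \<in> \<O>"
      using ab \<open>n \<ge> 1\<close> by (intro O_mult) auto
    then have "b * inverse P \<notin> \<O>"
      using x(2) unfolding ab(3) PM mem_lattice_of_powi_iff[OF ef(2)]
      by (simp add: power_int_diff divide_inverse mult.assoc)
    then have b: "inverse b \<in> \<O>" "b \<noteq> 0"
      using inverse_in_O[OF ab(2)] by auto
    have "a *s (P powi n *s e) \<in> L'"
      by (rule rsubspace_O_scale[OF subsp ab(1) Pn(1)])
    then have "b *s f \<in> L'"
      using rmod.subspace_diff[OF subsp x(1), of "(a * P powi n) *s e"] ab(3) by simp
    then have "inverse b *s (b *s f) \<in> L'"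
      by (rule rsubspace_O_scale[OF subsp b(1)])
    then show False
      using b(2) \<open>f \<notin> L'\<close> by simp
  qed
  \<comment> \<open>It remains to find \<open>P powi n *s e\<close> in \<open>L'\<close>. The
    \<open>f\<close>-part of \<open>y\<close> lies in \<open>p L\<close>, hence in
    \<open>L'\<close>, and what is left is a unit multiple of that vector.\<close>
  obtain y where y: "y \<in> L'" "y \<notin> (\<lambda>x. P *s x) ` L"
    using L_sub(4) by blast
  obtain a b where ab: "a \<in> \<O>" "b \<in> \<O>" "y = (a * P powi n) *s e + b *s f"
    using L_coords y(1) L_sub(1) by blast
  have "y \<in> lattice_of (P powi 1 *s e) (P powi 1 *s f)"
    using y(1) L'_PM PM by blast
  then have b: "b / P \<in> \<O>"
    unfolding ab(3) mem_lattice_of_powi_iff[OF ef(2)] by simp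
  moreover have "a * P powi n / P powi (n + 1) = a * inverse P"
    by (simp add: power_int_add divide_inverse)
  ultimately have "a * inverse P \<notin> \<O>"
    using y(2) unfolding ab(3) PL mem_lattice_of_powi_iff[OF ef(2)] by simp
  then have a: "inverse a \<in> \<O>" "a \<noteq> 0"
    using inverse_in_O[OF ab(1)] by auto
  have "a *s (P powi n *s e) \<in> L'"
    using rmod.subspace_diff[OF subsp y(1) L'_f[OF b]] ab(3) by simp
  then have "inverse a *s (a *s (P powi n *s e)) \<in> L'"
    by (rule rsubspace_O_scale[OF subsp a(1)])
  then have Pe: "P powi n *s e \<in> L'"
    using a(2) by (simp flip: mult.assoc)
  have "L \<inter> (\<lambda>x. P *s x) ` M \<subseteq> L'"
  proof
    fix z assume z: "z \<in> L \<inter> (\<lambda>x. P *s x) ` M"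
    then obtain c d where cd: "c \<in> \<O>" "z = (c * P powi n) *s e + d *s f"
      using L_coords by blast
    have "d / P \<in> \<O>"
      using z unfolding cd(2) PM Int_iff mem_lattice_of_powi_iff[OF ef(2)] by simp
    then show "z \<in> L'"
      using rmod.subspace_add[OF subsp rsubspace_O_scale[OF subsp cd(1) Pe] L'_f] cd(2) by simp
  qed
  then show ?thesis
    using L_sub(1) L'_PM by blast
qed

text \<open>With one choice of representatives \<open>M\<close> of \<open>r\<close> and
  \<open>L\<close> of \<open>v\<close>, both neighbours turn out to be the class of the same
  intersection.\<close>

lemma unique_parent:
  assumes r: "r \<in> homothety_classes"
    and w: "(v, w) \<in> parcs (bruhat_tits_graph p)" "vertex_dist p r w \<le> vertex_dist p r v"
    and w': "(v, w') \<in> parcs (bruhat_tits_graph p)" "vertex_dist p r w' \<le> vertex_dist p r v"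
  shows "w = w'"
proof -
  obtain M where M: "is_lattice M" "r = homothety `` {M}"
    using vertexE[OF r] .
  have "v \<in> homothety_classes"
    using w(1) by (simp add: parcs_bruhat_tits_graph)
  then obtain L0 where "is_lattice L0" "v = homothety `` {L0}"
    by (rule vertexE)
  then obtain L where L: "is_lattice L" "v = homothety `` {L}"
    "relative_exponents p M L (vertex_dist p r v, 0)"
    using normalised_representative[OF M(1)] vertex_dist_eq[OF M(1)] M(2) by metis
  have *: "x = homothety `` {L \<inter> (\<lambda>x. P *s x) ` M}"
    if x: "(v, x) \<in> parcs (bruhat_tits_graph p)" "vertex_dist p r x \<le> vertex_dist p r v" for x
  proof -
    have "x \<in> homothety_classes"
      using x(1) by (simp add: parcs_bruhat_tits_graph)
    then obtain L0 where L0: "is_lattice L0" "x = homothety `` {L0}"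
      by (rule vertexE)
    have "lattice_dist p L L0 = 1"
      using x(1) vertex_dist_eq[OF L(1) L0(1)] L(2) L0(2) by (simp add: parcs_bruhat_tits_graph)
    then obtain L' where L': "is_lattice L'" "homothety `` {L'} = x" "relative_exponents p L L' (1, 0)"
      using normalised_representative[OF L(1) L0(1)] L0(2) by metis
    have "lattice_dist p M L' \<le> vertex_dist p r v"
      using x(2) vertex_dist_eq[OF M(1) L'(1)] L'(2) M(2) by simp
    then have "L' = L \<inter> (\<lambda>x. P *s x) ` M"
      by (rule parent_eq[OF M(1) L'(1) L(3) L'(3)])
    then show ?thesis
      using L'(2) by simp
  qed
  show ?thesis
    using *[OF w] *[OF w'] by simp
qed

section \<open>Symmetry, absence of loops, and connectedness\<close>

lemma arc_sym:
  assumes "(v, w) \<in> parcs (bruhat_tits_graph p)"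
  shows "(w, v) \<in> parcs (bruhat_tits_graph p)"
proof -
  obtain M L where "is_lattice M" "v = homothety `` {M}" "is_lattice L" "w = homothety `` {L}"
    using assms unfolding parcs_bruhat_tits_graph by (meson vertexE)
  then show ?thesis
    using assms vertex_dist_eq lattice_dist_sym by (simp add: parcs_bruhat_tits_graph)
qed

lemma vertex_dist_self:
  assumes "v \<in> homothety_classes"
  shows "vertex_dist p v v = 0"
proof -
  obtain L where L: "is_lattice L" "v = homothety `` {L}"
    using vertexE[OF assms] .
  then show ?thesis
    using vertex_dist_eq[OF L(1) L(1)] lattice_dist_eq[OF relative_exponents_refl[OF L(1)]] by simp
qed

lemma pair_bidirected_bruhat_tits_graph: "pair_bidirected_digraph (bruhat_tits_graph p)"
proof unfold_locales
  fix e assume e: "e \<in> parcs (bruhat_tits_graph p)"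
  obtain v w where "e = (v, w)"
    by (cases e)
  with e show "fst e \<in> pverts (bruhat_tits_graph p)" "snd e \<in> pverts (bruhat_tits_graph p)"
    by (simp_all add: parcs_bruhat_tits_graph pverts_bruhat_tits_graph)
  show "fst e \<noteq> snd e"
    using e vertex_dist_self \<open>e = (v, w)\<close> by (auto simp: parcs_bruhat_tits_graph)
next
  show "symmetric (with_proj (bruhat_tits_graph p))"
    using arc_sym by (auto simp: symmetric_def sym_def)
qed

lemma reachable_bruhat_tits_graph:
  assumes ef: "wedge e f \<noteq> 0"
  shows "reachable (with_proj (bruhat_tits_graph p))
    (homothety `` {lattice_of e f}) (homothety `` {lattice_of (P powi int n *s e) f})"
proof -
  interpret pair_bidirected_digraph "bruhat_tits_graph p"
    by (rule pair_bidirected_bruhat_tits_graph)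
  have wedge: "wedge (P powi int n *s e) f \<noteq> 0" for n
    using wedge_powi_nonzero[OF ef, of "int n" 0] by simp
  show ?thesis
  proof (induction n)
    case 0
    show ?case
      using class_is_vertex[OF is_lattice_lattice_of[OF ef]] by (simp add: pverts_bruhat_tits_graph)
  next
    case (Suc n)
    define L L' where "L = lattice_of (P powi int n *s e) f"
      and "L' = lattice_of (P powi int (Suc n) *s e) f"
    have lat: "is_lattice L" "is_lattice L'"
      unfolding L_def L'_def by (intro is_lattice_lattice_of wedge)+
    have "P powi int (Suc n) *s e = P powi 1 *s (P powi int n *s e)"
      by (simp only: power_int_of_nat power_int_1_right power_Suc vec.scale_scale)
    then have "L' = lattice_of (P powi 1 *s (P powi int n *s e)) (P powi 0 *s f)"
      unfolding L'_def by (simp only: power_int_0_right vec.scale_one)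
    then have "relative_exponents p L L' (1, 0)"
      using wedge[of n] L_def zero_le_one unfolding relative_exponents_iff by blast
    then have "(homothety `` {L}, homothety `` {L'}) \<in> parcs (bruhat_tits_graph p)"
      using lat by (simp add: parcs_bruhat_tits_graph class_is_vertex vertex_dist_eq lattice_dist_eq)
    then show ?case
      using reachable_adj_trans[OF Suc] by (simp add: L_def L'_def)
  qed
qed

lemma connected_bruhat_tits_graph:
  "Digraph_Component.connected (with_proj (bruhat_tits_graph p))"
proof -
  interpret pair_bidirected_digraph "bruhat_tits_graph p"
    by (rule pair_bidirected_bruhat_tits_graph)
  show ?thesis
    unfolding Digraph_Component.connected_def
  \<comment> \<open>Connectedness means strong connectedness of the symmetrised graph, so directed
    walks in the graph itself suffice.\<close>
  proof (rule strongly_connectedI)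
    show "verts (with_proj (mk_symmetric (with_proj (bruhat_tits_graph p)))) \<noteq> {}"
      using ex_vertex by (simp add: pverts_bruhat_tits_graph)
  next
    fix v w
    assume "v \<in> verts (with_proj (mk_symmetric (with_proj (bruhat_tits_graph p))))"
      and "w \<in> verts (with_proj (mk_symmetric (with_proj (bruhat_tits_graph p))))"
    then have vw: "v \<in> homothety_classes" "w \<in> homothety_classes"
      by (simp_all add: pverts_bruhat_tits_graph)
    obtain M where M: "is_lattice M" "v = homothety `` {M}"
      using vertexE[OF vw(1)] .
    obtain L0 where L0: "is_lattice L0" "w = homothety `` {L0}"
      using vertexE[OF vw(2)] .
    obtain L where L: "homothety `` {L} = homothety `` {L0}"
      "relative_exponents p M L (lattice_dist p M L0, 0)"
      using normalised_representative[OF M(1) L0(1)] .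
    \<comment> \<open>The lower exponent is 0, so \<open>f\<close> stays unscaled and the other
      exponent is nonnegative; \<open>nat\<close> therefore loses nothing.\<close>
    obtain e f where ef: "wedge e f \<noteq> 0" "M = lattice_of e f"
      "L = lattice_of (P powi int (nat (lattice_dist p M L0)) *s e) f"
      using L(2) by (auto simp: relative_exponents_iff)
    have "reachable (with_proj (bruhat_tits_graph p)) v w"
      using reachable_bruhat_tits_graph[OF ef(1), of "nat (lattice_dist p M L0)"] M(2) L0(2) L(1) ef(2,3)
      by simp
    then show "reachable (with_proj (mk_symmetric (with_proj (bruhat_tits_graph p)))) v w"
      by (rule reachable_mk_symmetricI)
  qed
qed

lemma acyclic_bruhat_tits_graph: "acyclic_graph (bruhat_tits_graph p)"
proof -
  obtain r :: "('r fract ^ 2) set set" where "r \<in> homothety_classes"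
    using ex_vertex by blast
  then show ?thesis
    using acyclic_graph_if_unique_parent[of "bruhat_tits_graph p" "vertex_dist p r"]
      arc_sym unique_parent by blast
qed

end

theorem mainTheorem1:
  fixes p :: "'r::idom"
  assumes "discrete_valuation_ring TYPE('r)"
    and "uniformiser p"
  shows "tree_graph (bruhat_tits_graph p)"
proof -
  interpret dvr p
    using assms by unfold_locales
  show ?thesis
    by (simp add: tree_graph_def pair_bidirected_bruhat_tits_graph connected_bruhat_tits_graph
        acyclic_bruhat_tits_graph)
qed

end
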